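(* Fix $r\ge2$ and suppose $\boldsymbol A_n=((a_{i_1,\dots,i_r}))_{1\le i_1,\dots,i_r\le n}$ is a sequence (in $n$) of real $r$-tensors satisfying: (1) for all $1\le s\le r$ and all $1\le i_1,\dots,i_{s-1},i_{s+1},\dots,i_r\le n$, $\displaystyle\sum_{i_s=1}^na_{i_1,i_2,\dots,i_r}=0$; (2) there are universal constants $K_1,K_2>0$ such that $|a_{i_1,\dots,i_r}|\le K_1/\sqrt n$ for all $1\le i_1,\dots,i_r\le n$, and $\displaystyle\sum_{1\le i_1,\dots,i_r\le n}a_{i_1,\dots,i_r}^2\ge K_2n^{r-1}$. Let $\pi_1,\dots,\pi_{r-1}$ be independent (uniform) random permutations of $\{1,\dots,n\}$ and define $$C_n=\sum_{i=1}^na_{i,\pi_1(i),\dots,\pi_{r-1}(i)}.$$ Then, as $n\to\infty$, $$\frac{C_n}{\sqrt{\mathrm{Var}[C_n]}}\xrightarrow{D}N(0,1).$$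
   Context: The entries $a_{i_1,\dots,i_r}$ may depend on $n$; the constants $K_1,K_2$ do not. *)

theory Defs
  imports "HOL-Probability.Probability" "HOL-Combinatorics.Permutations"
begin

text \<open>
  An \<open>r\<close>-tensor of size \<open>n\<close> is a function on multi-indices \<open>{1..r} \<rightarrow>\<^sub>E {1..n}\<close>; its values
  elsewhere are irrelevant.
\<close>

definition multi_indices :: "nat \<Rightarrow> nat \<Rightarrow> (nat \<Rightarrow> nat) set" where
  "multi_indices r n = {1..r} \<rightarrow>\<^sub>E {1..n}"

text \<open>The remaining indices, when the index in position \<open>s\<close> is left out.\<close>

definition multi_indices_omit :: "nat \<Rightarrow> nat \<Rightarrow> nat \<Rightarrow> (nat \<Rightarrow> nat) set" where
  "multi_indices_omit r n s = ({1..r} - {s}) \<rightarrow>\<^sub>E {1..n}"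

text \<open>The multi-index \<open>(i, \<pi>\<^sub>1(i), \<dots>, \<pi>\<^sub>r\<^sub>-\<^sub>1(i))\<close>; note the shift by one in the numbering.\<close>

definition perm_index :: "nat \<Rightarrow> (nat \<Rightarrow> nat \<Rightarrow> nat) \<Rightarrow> nat \<Rightarrow> nat \<Rightarrow> nat" where
  "perm_index r \<pi> i = (\<lambda>s\<in>{1..r}. if s = 1 then i else \<pi> (s - 1) i)"

definition perm_sum ::
    "nat \<Rightarrow> nat \<Rightarrow> ((nat \<Rightarrow> nat) \<Rightarrow> real) \<Rightarrow> (nat \<Rightarrow> nat \<Rightarrow> nat) \<Rightarrow> real" where
  "perm_sum r n a \<pi> = (\<Sum>i = 1..n. a (perm_index r \<pi> i))"

text \<open>
  \<open>X 1, \<dots>, X m\<close> are independent, uniformly distributed random permutations of \<open>{1..n}\<close> on the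
  probability space \<open>M\<close>.
\<close>

definition indep_uniform_perms ::
    "'w measure \<Rightarrow> nat \<Rightarrow> nat \<Rightarrow> (nat \<Rightarrow> 'w \<Rightarrow> nat \<Rightarrow> nat) \<Rightarrow> bool" where
  "indep_uniform_perms M m n X \<longleftrightarrow>
     prob_space M \<and>
     prob_space.indep_vars M (\<lambda>_. count_space {p. p permutes {1..n}}) X {1..m} \<and>
     (\<forall>s\<in>{1..m}. distr M (count_space {p. p permutes {1..n}}) (X s) =
        uniform_count_measure {p. p permutes {1..n}})"

end

theory Submission imports Defs begin

text \<open>
  Stein's method for exchangeable pairs, applied to characteristic functions. Composing the first
  permutation with a random transposition \<open>(I J)\<close> changes \<open>C\<close> by some \<open>D I J\<close>, and because all the
  line sums of the tensor vanish, the regression of this increment is exactly linear. Hence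
  \<open>E[C f(C)] = (1 / 4n) E[\<Sum> D (f(C + D) - f(C))]\<close>. Since \<open>D = O(n powr (-1/2))\<close>, for
  \<open>f = exp(\<i>u\<cdot>)\<close> the right-hand side is \<open>\<i>u E[T f(C)]\<close> up to a small error, where
  \<open>T = (1 / 4n) \<Sum> D\<^sup>2\<close> has mean \<open>Var C\<close>. A transposition of any of the permutations changes \<open>T\<close> only by
  \<open>O(1/n)\<close>, so \<open>T\<close> concentrates by an Efron--Stein argument. Thus the characteristic function of \<open>C\<close>
  almost satisfies \<open>\<phi>' = - u Var(C) \<phi>\<close>. An exact second-moment computation keeps \<open>Var C\<close> away from 0,
  and Levy's continuity theorem concludes.
\<close>

section \<open>Averages and variances over finite sets\<close>

text \<open>Values in any real vector space, so that the same average serves the real statistic and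
  its complex characteristic function.\<close>

definition avg :: "'a set \<Rightarrow> ('a \<Rightarrow> 'b::real_vector) \<Rightarrow> 'b" where
  "avg A f = (\<Sum>x\<in>A. f x) /\<^sub>R real (card A)"

definition var :: "'a set \<Rightarrow> ('a \<Rightarrow> real) \<Rightarrow> real" where
  "var A f = avg A (\<lambda>x. (f x - avg A f)\<^sup>2)"

lemma avg_cong: "(\<And>x. x \<in> A \<Longrightarrow> f x = g x) \<Longrightarrow> avg A f = avg A g"
  by (simp add: avg_def)

lemma avg_add: "avg A (\<lambda>x. f x + g x) = avg A f + avg A g"
  by (simp add: avg_def sum.distrib scaleR_right_distrib)

lemma avg_diff: "avg A (\<lambda>x. f x - g x) = avg A f - avg A g"
  by (simp add: avg_def sum_subtractf scaleR_right_diff_distrib)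

lemma avg_minus: "avg A (\<lambda>x. - f x) = - avg A f"
  by (simp add: avg_def sum_negf)

lemma avg_scaleR: "avg A (\<lambda>x. c *\<^sub>R f x) = c *\<^sub>R avg A f"
  by (simp add: avg_def scaleR_sum_right[symmetric] mult.commute)

lemma avg_mult_left: "avg A (\<lambda>x. c * f x) = c * avg A f" for f :: "'a \<Rightarrow> 'b::real_algebra"
  by (simp add: avg_def sum_distrib_left)

lemma avg_sum: "avg A (\<lambda>x. \<Sum>i\<in>I. f i x) = (\<Sum>i\<in>I. avg A (f i))"
  by (simp add: avg_def sum.swap[of _ I] scaleR_sum_right)

lemma avg_const: "finite A \<Longrightarrow> A \<noteq> {} \<Longrightarrow> avg A (\<lambda>_. c) = c"
  by (simp add: avg_def sum_constant_scaleR)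

lemma avg_mono: "(\<And>x. x \<in> A \<Longrightarrow> f x \<le> g x) \<Longrightarrow> avg A f \<le> avg A g" for f :: "'a \<Rightarrow> real"
  by (simp add: avg_def sum_mono mult_left_mono)

lemma avg_nonneg: "(\<And>x. x \<in> A \<Longrightarrow> 0 \<le> f x) \<Longrightarrow> 0 \<le> avg A f" for f :: "'a \<Rightarrow> real"
  by (simp add: avg_def sum_nonneg)

lemma avg_le_const:
  fixes f :: "'a \<Rightarrow> real"
  assumes "finite A" "A \<noteq> {}" "\<And>x. x \<in> A \<Longrightarrow> f x \<le> c"
  shows "avg A f \<le> c"
  using avg_mono[of A f "\<lambda>_. c"] assms by (simp add: avg_const)

lemma norm_avg_le: "norm (avg A f) \<le> avg A (\<lambda>x. norm (f x))"
  by (simp add: avg_def mult_left_mono norm_sum)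

lemma avg_swap: "avg A (\<lambda>x. avg B (f x)) = avg B (\<lambda>y. avg A (\<lambda>x. f x y))"
  by (simp add: avg_def scaleR_sum_right sum.swap[of _ A] mult.commute)

lemma avg_bij_betw: "bij_betw h A A \<Longrightarrow> avg A (\<lambda>x. f (h x)) = avg A f"
  unfolding avg_def by (simp add: sum.reindex_bij_betw)

text \<open>Bias-variance decomposition: expanding about the mean, the cross term averages to 0.
  Both variance inductions rest on it.\<close>

lemma avg_sq_dev:
  assumes "finite A" "A \<noteq> {}"
  shows "avg A (\<lambda>x. (f x - c)\<^sup>2) = var A f + (avg A f - c)\<^sup>2"
proof -
  define m where "m = avg A f"
  have "avg A (\<lambda>x. (f x - c)\<^sup>2) = avg A (\<lambda>x. (f x - m)\<^sup>2 + (2 * (m - c) * (f x - m) + (m - c)\<^sup>2))"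
    by (intro avg_cong) (simp add: power2_eq_square algebra_simps)
  also have "\<dots> = var A f + (2 * (m - c) * (avg A f - m) + (m - c)\<^sup>2)"
    by (simp only: avg_add avg_mult_left avg_diff avg_const[OF assms] var_def m_def)
  finally show ?thesis by (simp add: m_def)
qed

lemma var_nonneg: "0 \<le> var A f"
  unfolding var_def by (intro avg_nonneg) simp

lemma var_le: "finite A \<Longrightarrow> A \<noteq> {} \<Longrightarrow> var A f \<le> avg A (\<lambda>x. (f x - c)\<^sup>2)"
  by (simp add: avg_sq_dev)

lemma avg_power2_le: "finite A \<Longrightarrow> A \<noteq> {} \<Longrightarrow> (avg A f)\<^sup>2 \<le> avg A (\<lambda>x. (f x)\<^sup>2)" for f :: "'a \<Rightarrow> real"
  using avg_sq_dev[of A f 0] var_nonneg[of A f] by simp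

lemma avg_abs_dev_le:
  assumes "finite A" "A \<noteq> {}"
  shows "avg A (\<lambda>x. \<bar>f x - avg A f\<bar>) \<le> sqrt (var A f)"
  using avg_power2_le[OF assms, of "\<lambda>x. \<bar>f x - avg A f\<bar>"] by (simp add: var_def real_le_rsqrt)

section \<open>Variance inequalities for permutations and for product spaces\<close>

lemma var_avg_le:
  assumes "finite B" "B \<noteq> {}"
  shows "var A (\<lambda>x. avg B (\<lambda>y. f x y)) \<le> avg B (\<lambda>y. var A (\<lambda>x. f x y))"
proof -
  have "var A (\<lambda>x. avg B (f x)) = avg A (\<lambda>x. (avg B (\<lambda>y. f x y - avg A (\<lambda>x. f x y)))\<^sup>2)"
    by (simp add: var_def avg_swap[of A B] avg_diff)
  \<comment> \<open>Jensen's inequality for the square, after centring separately for each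
    \<open>y\<close>.\<close>
  also have "\<dots> \<le> avg A (\<lambda>x. avg B (\<lambda>y. (f x y - avg A (\<lambda>x. f x y))\<^sup>2))"
    by (intro avg_mono avg_power2_le assms)
  also have "\<dots> = avg B (\<lambda>y. var A (\<lambda>x. f x y))"
    by (simp add: var_def avg_swap[of A B])
  finally show ?thesis .
qed

text \<open>Since \<open>q\<close> fixes \<open>a\<close>, the composed permutation sends
  \<open>a\<close> to \<open>b\<close>; the formula conditions a uniform permutation on the image of
  \<open>a\<close>.\<close>

lemma avg_permutations_insert:
  assumes "finite S" "a \<notin> S"
  shows "avg {p. p permutes insert a S} f =
    avg (insert a S) (\<lambda>b. avg {p. p permutes S} (\<lambda>q. f (Transposition.transpose a b \<circ> q)))"
  using assms
  by (simp add: avg_def sum_over_permutations_insert card_permutations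
      scaleR_sum_right[symmetric] mult.commute field_simps)

text \<open>
  Disintegrating over the image \<open>b\<close> of the new point, each conditional function is again
  Lipschitz, and the conditional means differ by at most \<open>c\<close> from the one for \<open>b = a\<close>.
\<close>
lemma var_permutations_le:
  assumes "finite S"
    and "\<And>p x y. p permutes S \<Longrightarrow> x \<in> S \<Longrightarrow> y \<in> S \<Longrightarrow> \<bar>f (p \<circ> Transposition.transpose x y) - f p\<bar> \<le> c"
  shows "var {p. p permutes S} f \<le> real (card S) * c\<^sup>2"
  using assms
proof (induction S arbitrary: f rule: finite_induct)
  case empty
  then show ?case by (simp add: var_def avg_def)
next
  case (insert a S)
  let ?P = "{p. p permutes S}" and ?P' = "{p. p permutes insert a S}"
  have P: "finite ?P" "?P \<noteq> {}" and P': "finite ?P'" "?P' \<noteq> {}"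
    using insert.hyps by (auto simp: finite_permutations intro: permutes_id)
  define F where "F = (\<lambda>b q. f (Transposition.transpose a b \<circ> q))"
  have perm: "Transposition.transpose a b \<circ> q permutes insert a S" if "q permutes S" "b \<in> insert a S" for b q
    using that by (intro permutes_compose permutes_swap_id) (auto intro: permutes_subset)
  have var_F: "var ?P (F b) \<le> real (card S) * c\<^sup>2" if b: "b \<in> insert a S" for b
  proof (rule insert.IH)
    fix p x y assume "p permutes S" "x \<in> S" "y \<in> S"
    then show "\<bar>F b (p \<circ> Transposition.transpose x y) - F b p\<bar> \<le> c"
      using insert.prems[of "Transposition.transpose a b \<circ> p" x y] perm[of p b] b
      by (simp only: F_def comp_assoc insert_iff simp_thms)
  qed
  have mean_F: "(avg ?P (F b) - avg ?P (F a))\<^sup>2 \<le> c\<^sup>2" if b: "b \<in> insert a S" for b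
  proof -
    have "\<bar>F b q - F a q\<bar> \<le> c" if q: "q permutes S" for q
    proof -
      have q': "q permutes insert a S" using q by (rule permutes_subset) auto
      \<comment> \<open>Conjugation by \<open>q\<close> turns the transposition on the left into one
        on the right, the kind that the hypothesis controls.\<close>
      have "Transposition.transpose a b \<circ> q = q \<circ> Transposition.transpose (inv q a) (inv q b)"
        using permutes_bij[OF q] by (rule transpose_comp_eq)
      then have "F b q = f (q \<circ> Transposition.transpose (inv q a) (inv q b))" "F a q = f q"
        by (simp_all only: F_def) simp
      moreover have "inv q a \<in> insert a S" "inv q b \<in> insert a S"
        using permutes_in_image[OF permutes_inv[OF q']] b by auto
      ultimately show ?thesis using insert.prems[OF q'] by presburger
    qed
    then have "\<bar>avg ?P (F b) - avg ?P (F a)\<bar> \<le> c"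
      unfolding avg_diff[symmetric] using norm_avg_le[of ?P "\<lambda>q. F b q - F a q"]
        avg_le_const[OF P, of "\<lambda>q. \<bar>F b q - F a q\<bar>" c] by simp
    then show ?thesis by (metis abs_ge_zero power2_abs power_mono)
  qed
  \<comment> \<open>Centring at the conditional mean for \<open>b = a\<close> can only increase the
    value; each conditional second moment is then a variance plus a squared difference of
    means.\<close>
  have "var ?P' f \<le> avg ?P' (\<lambda>p. (f p - avg ?P (F a))\<^sup>2)"
    using P' by (rule var_le)
  also have "\<dots> = avg (insert a S) (\<lambda>b. avg ?P (\<lambda>q. (F b q - avg ?P (F a))\<^sup>2))"
    using insert.hyps by (simp add: avg_permutations_insert F_def)
  also have "\<dots> = avg (insert a S) (\<lambda>b. var ?P (F b) + (avg ?P (F b) - avg ?P (F a))\<^sup>2)"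
    by (simp only: avg_sq_dev[OF P])
  also have "\<dots> \<le> real (card S) * c\<^sup>2 + c\<^sup>2"
    using insert.hyps by (intro avg_le_const add_mono var_F mean_F) auto
  finally show ?case using insert.hyps by (simp add: algebra_simps)
qed

lemma avg_PiE_insert:
  assumes "finite I" "i \<notin> I" "\<And>j. j \<in> I \<Longrightarrow> finite (A j)" "finite (A i)"
  shows "avg (PiE (insert i I) A) f = avg (A i) (\<lambda>x. avg (PiE I A) (\<lambda>w. f (w(i := x))))"
proof -
  have inj: "inj_on (\<lambda>(y, g). g(i := y)) (A i \<times> PiE I A)"
    using assms(2) by (rule inj_combinator)
  have "(\<Sum>w\<in>PiE (insert i I) A. f w) = (\<Sum>x\<in>A i. \<Sum>w\<in>PiE I A. f (w(i := x)))"
    unfolding PiE_insert_eq sum.reindex[OF inj]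
    by (simp add: sum.cartesian_product o_def case_prod_unfold)
  then show ?thesis
    using assms by (simp add: avg_def card_PiE scaleR_sum_right[symmetric] mult.commute)
qed

text \<open>By the law of total variance, splitting off coordinate \<open>i\<close> leaves the mean
  conditional variance, bounded by induction, and the variance of the conditional mean, at most
  \<open>V\<close> by \<open>var_avg_le\<close>.\<close>

lemma efron_stein_inequality:
  fixes f :: "('i \<Rightarrow> 'a) \<Rightarrow> real"
  assumes "finite I" "\<And>i. i \<in> I \<Longrightarrow> finite (A i)" "\<And>i. i \<in> I \<Longrightarrow> A i \<noteq> {}"
    and "\<And>i w. i \<in> I \<Longrightarrow> w \<in> PiE I A \<Longrightarrow> var (A i) (\<lambda>x. f (w(i := x))) \<le> V"
  shows "var (PiE I A) f \<le> real (card I) * V"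
  using assms
proof (induction I arbitrary: f rule: finite_induct)
  case empty
  then show ?case by (simp add: var_def avg_def)
next
  case (insert i I)
  let ?P = "PiE I A" and ?P' = "PiE (insert i I) A"
  have P: "finite ?P" "?P \<noteq> {}" and P': "finite ?P'" "?P' \<noteq> {}" and Ai: "finite (A i)" "A i \<noteq> {}"
    using insert.hyps(1) insert.prems(1,2) by (auto simp: PiE_eq_empty_iff intro!: finite_PiE)
  define F where "F = (\<lambda>x w. f (w(i := x)))"
  have ins: "w(i := x) \<in> ?P'" if "w \<in> ?P" "x \<in> A i" for w x
    using that by (auto simp: PiE_insert_eq intro!: image_eqI[of _ _ "(x, w)"])
  have var_F: "var ?P (F x) \<le> real (card I) * V" if x: "x \<in> A i" for x
  proof (rule insert.IH)
    fix j w assume j: "j \<in> I" and w: "w \<in> ?P"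
    have "(\<lambda>y. F x (w(j := y))) = (\<lambda>y. f ((w(i := x))(j := y)))"
      using j insert.hyps(2) by (subst fun_upd_twist[of i j]) (auto simp: F_def)
    then show "var (A j) (\<lambda>y. F x (w(j := y))) \<le> V"
      using insert.prems(3)[OF insertI2[OF j] ins[OF w x]] by (simp only:)
  qed (use insert.prems in auto)
  have var_i: "var (A i) (\<lambda>x. F x w) \<le> V" if w: "w \<in> ?P" for w
  proof -
    \<comment> \<open>The hypothesis wants a point of the full product; any value in coordinate
      \<open>i\<close> will do, as it is overwritten at once.\<close>
    obtain x where "x \<in> A i" using Ai by blast
    then show ?thesis using insert.prems(3)[OF insertI1 ins[OF w]] by (simp only: F_def fun_upd_upd)
  qed
  define m where "m = avg (A i) (\<lambda>x. avg ?P (F x))"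
  have "var ?P' f \<le> avg ?P' (\<lambda>p. (f p - m)\<^sup>2)"
    using P' by (rule var_le)
  also have "\<dots> = avg (A i) (\<lambda>x. avg ?P (\<lambda>w. (F x w - m)\<^sup>2))"
    using insert.hyps insert.prems(1) by (simp add: avg_PiE_insert F_def)
  also have "\<dots> = avg (A i) (\<lambda>x. var ?P (F x)) + var (A i) (\<lambda>x. avg ?P (F x))"
    by (simp add: avg_sq_dev[OF P] avg_add var_def[of "A i"] m_def)
  also have "\<dots> \<le> real (card I) * V + V"
    by (intro add_mono avg_le_const order.trans[OF var_avg_le] var_F var_i P Ai)
  finally show ?case using insert.hyps by (simp add: algebra_simps)
qed

section \<open>The exchangeable pair\<close>

definition perms :: "nat \<Rightarrow> nat \<Rightarrow> (nat \<Rightarrow> nat \<Rightarrow> nat) set" where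
  "perms m n = PiE {1..m} (\<lambda>_. {p. p permutes {1..n}})"

text \<open>Composing on the right exchanges the values at positions \<open>x\<close> and
  \<open>y\<close>, so at most two summands of \<open>perm_sum\<close> change.\<close>

definition swap :: "nat \<Rightarrow> nat \<Rightarrow> nat \<Rightarrow> (nat \<Rightarrow> nat \<Rightarrow> nat) \<Rightarrow> nat \<Rightarrow> nat \<Rightarrow> nat" where
  "swap s x y \<pi> = \<pi>(s := \<pi> s \<circ> Transposition.transpose x y)"

lemma finite_perms: "finite (perms m n)"
  unfolding perms_def by (intro finite_PiE) (auto simp: finite_permutations)

lemma perms_nonempty: "perms m n \<noteq> {}"
  unfolding perms_def PiE_eq_empty_iff using permutes_id by blast

lemma perms_permutes: "\<pi> \<in> perms m n \<Longrightarrow> s \<in> {1..m} \<Longrightarrow> \<pi> s permutes {1..n}"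
  by (auto simp: perms_def PiE_iff)

lemma swap_perms:
  assumes "\<pi> \<in> perms m n" "s \<in> {1..m}" "x \<in> {1..n}" "y \<in> {1..n}"
  shows "swap s x y \<pi> \<in> perms m n"
proof -
  have "\<pi> s \<circ> Transposition.transpose x y permutes {1..n}"
    using perms_permutes[OF assms(1,2)] assms(3,4)
    by (intro permutes_compose permutes_swap_id)
  then show ?thesis
    using assms(1,2) by (auto simp: perms_def swap_def PiE_iff extensional_def)
qed

lemma swap_swap [simp]: "swap s x y (swap s x y \<pi>) = \<pi>"
  by (simp add: swap_def comp_assoc)

lemma swap_same [simp]: "swap s x x \<pi> = \<pi>"
  by (simp add: swap_def)

text \<open>A swap is an involution of \<open>perms m n\<close>, hence preserves the uniform
  average. This is the exchangeability of the pair.\<close>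

lemma avg_perms_swap:
  assumes "s \<in> {1..m}" "x \<in> {1..n}" "y \<in> {1..n}"
  shows "avg (perms m n) (\<lambda>\<pi>. f (swap s x y \<pi>)) = avg (perms m n) f"
  using assms by (intro avg_bij_betw bij_betwI[of _ _ _ "swap s x y"]) (auto simp: swap_perms)

lemma perm_index_swap:
  "s \<in> {1..r - 1} \<Longrightarrow> perm_index r (swap s x y \<pi>) i
    = (perm_index r \<pi> i)(Suc s := \<pi> s (Transposition.transpose x y i))"
  by (auto simp: perm_index_def swap_def fun_eq_iff restrict_def)

lemma perm_index_swap_other:
  "i \<noteq> x \<Longrightarrow> i \<noteq> y \<Longrightarrow> perm_index r (swap s x y \<pi>) i = perm_index r \<pi> i"
  by (auto simp: perm_index_def swap_def fun_eq_iff restrict_def)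

lemma perm_index_in:
  assumes "\<pi> \<in> perms (r - 1) n" "i \<in> {1..n}"
  shows "perm_index r \<pi> i \<in> multi_indices r n"
proof -
  have "\<pi> (s - 1) i \<in> {1..n}" if "s \<in> {1..r}" "s \<noteq> 1" for s
  proof -
    have "s - 1 \<in> {1..r - 1}" using that unfolding atLeastAtMost_iff by arith
    then show ?thesis using permutes_in_image[OF perms_permutes[OF assms(1)]] assms(2) by blast
  qed
  then show ?thesis
    using assms(2) by (auto simp: perm_index_def multi_indices_def PiE_iff)
qed

lemma multi_indices_upd:
  "v \<in> multi_indices r n \<Longrightarrow> s \<in> {1..r} \<Longrightarrow> j \<in> {1..n} \<Longrightarrow> v(s := j) \<in> multi_indices r n"
  by (auto simp: multi_indices_def PiE_iff extensional_def)

text \<open>The size is fixed here, and \<open>K\<close> will be K1 / sqrt n. The bound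
  \<open>3 \<le> n\<close> makes 1 / (n - 1) at most 1 / 2, which the lower bound on the variance
  uses.\<close>

locale zero_sum_tensor =
  fixes r n :: nat and a :: "(nat \<Rightarrow> nat) \<Rightarrow> real" and K :: real
  assumes r2: "2 \<le> r" and n3: "3 \<le> n"
    and zero_sum: "\<And>s i. s \<in> {1..r} \<Longrightarrow> i \<in> multi_indices_omit r n s \<Longrightarrow> (\<Sum>j = 1..n. a (i(s := j))) = 0"
    and bound: "\<And>i. i \<in> multi_indices r n \<Longrightarrow> \<bar>a i\<bar> \<le> K"
begin

abbreviation "\<Omega> \<equiv> perms (r - 1) n"
abbreviation "C \<equiv> perm_sum r n a"

lemma K_nonneg: "0 \<le> K"
proof -
  have "(\<lambda>s\<in>{1..r}. 1) \<in> multi_indices r n"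
    using n3 by (auto simp: multi_indices_def)
  then show ?thesis using bound by (meson abs_ge_zero order_trans)
qed

lemma sum_coord:
  assumes "v \<in> multi_indices r n" "s \<in> {1..r}"
  shows "(\<Sum>j = 1..n. a (v(s := j))) = 0"
proof -
  have restr: "restrict v ({1..r} - {s}) \<in> multi_indices_omit r n s"
    using assms(1) by (auto simp: multi_indices_omit_def multi_indices_def PiE_iff)
  have upd: "(restrict v ({1..r} - {s}))(s := j) = v(s := j)" for j
    using assms(1) by (auto simp: multi_indices_def PiE_iff extensional_def fun_eq_iff)
  show ?thesis using zero_sum[OF assms(2) restr] by (simp only: upd)
qed

lemma sum_coord_permutes:
  assumes "v \<in> multi_indices r n" "s \<in> {1..r}" "p permutes {1..n}"
  shows "(\<Sum>j = 1..n. a (v(s := p j))) = 0"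
  using sum.permute[OF assms(3), of "\<lambda>j. a (v(s := j))"] sum_coord[OF assms(1,2)] by (simp add: o_def)

definition D :: "(nat \<Rightarrow> nat \<Rightarrow> nat) \<Rightarrow> nat \<Rightarrow> nat \<Rightarrow> real" where
  "D \<pi> I J = C (swap 1 I J \<pi>) - C \<pi>"

text \<open>Only the summands at \<open>I\<close> and \<open>J\<close> survive the difference, and
  only in coordinate 2, the one filled by \<open>\<pi> 1\<close>. For \<open>I = J\<close> both
  sides vanish.\<close>

lemma D_eq:
  assumes "I \<in> {1..n}" "J \<in> {1..n}"
  shows "D \<pi> I J = a ((perm_index r \<pi> I)(2 := \<pi> 1 J)) + a ((perm_index r \<pi> J)(2 := \<pi> 1 I))
    - a (perm_index r \<pi> I) - a (perm_index r \<pi> J)"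
proof (cases "I = J")
  case True
  have "(perm_index r \<pi> I)(2 := \<pi> 1 I) = perm_index r \<pi> I"
    using r2 by (auto simp: perm_index_def fun_eq_iff)
  then show ?thesis using True by (simp add: D_def)
next
  case False
  let ?v = "perm_index r \<pi>" and ?\<tau> = "Transposition.transpose I J"
  have "D \<pi> I J = (\<Sum>i = 1..n. a ((?v i)(2 := \<pi> 1 (?\<tau> i))) - a (?v i))"
    using r2 by (simp add: D_def perm_sum_def perm_index_swap sum_subtractf numeral_2_eq_2)
  also have "\<dots> = (\<Sum>i\<in>{I, J}. a ((?v i)(2 := \<pi> 1 (?\<tau> i))) - a (?v i))"
  proof (rule sum.mono_neutral_right)
    have "(?v i)(2 := \<pi> 1 (?\<tau> i)) = ?v i" if "i \<notin> {I, J}" for i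
      using r2 that by (auto simp: perm_index_def fun_eq_iff)
    then show "\<forall>i\<in>{1..n} - {I, J}. a ((?v i)(2 := \<pi> 1 (?\<tau> i))) - a (?v i) = 0"
      by simp
  qed (use assms in auto)
  also have "\<dots> = a ((?v I)(2 := \<pi> 1 J)) + a ((?v J)(2 := \<pi> 1 I)) - a (?v I) - a (?v J)"
    using False by simp
  finally show ?thesis .
qed

lemma D_bound:
  assumes "\<pi> \<in> \<Omega>" "I \<in> {1..n}" "J \<in> {1..n}"
  shows "\<bar>D \<pi> I J\<bar> \<le> 4 * K"
proof -
  let ?v = "perm_index r \<pi>"
  have "\<pi> 1 I \<in> {1..n}" "\<pi> 1 J \<in> {1..n}"
    using permutes_in_image[OF perms_permutes[OF assms(1), of 1]] r2 assms by auto
  then have "\<bar>a ((?v I)(2 := \<pi> 1 J))\<bar> \<le> K" "\<bar>a ((?v J)(2 := \<pi> 1 I))\<bar> \<le> K"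
    "\<bar>a (?v I)\<bar> \<le> K" "\<bar>a (?v J)\<bar> \<le> K"
    using assms r2 by (auto intro!: bound multi_indices_upd perm_index_in)
  then show ?thesis unfolding D_eq[OF assms(2,3)] by linarith
qed

text \<open>For fixed \<open>I\<close>, \<open>\<pi> 1 J\<close> runs through a whole line of the
  tensor, so both mixed terms sum to 0; each of the two remaining terms contributes
  \<open>- n * C \<pi>\<close>.\<close>

lemma sum_D:
  assumes "\<pi> \<in> \<Omega>"
  shows "(\<Sum>I = 1..n. \<Sum>J = 1..n. D \<pi> I J) = - 2 * real n * C \<pi>"
proof -
  let ?v = "perm_index r \<pi>"
  have p: "\<pi> 1 permutes {1..n}" using perms_permutes[OF assms] r2 by simp
  have z: "(\<Sum>J = 1..n. a ((?v I)(2 := \<pi> 1 J))) = 0" if "I \<in> {1..n}" for I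
    using that r2 by (intro sum_coord_permutes perm_index_in assms p) auto
  have zz: "(\<Sum>I = 1..n. \<Sum>J = 1..n. a ((?v I)(2 := \<pi> 1 J))) = 0"
    by (intro sum.neutral ballI z)
  have "(\<Sum>I = 1..n. \<Sum>J = 1..n. D \<pi> I J) = (\<Sum>I = 1..n. \<Sum>J = 1..n.
    a ((?v I)(2 := \<pi> 1 J)) + a ((?v J)(2 := \<pi> 1 I)) - a (?v I) - a (?v J))"
    by (intro sum.cong refl D_eq)
  also have "\<dots> =
    (\<Sum>I = 1..n. \<Sum>J = 1..n. a ((?v I)(2 := \<pi> 1 J))) + (\<Sum>I = 1..n. \<Sum>J = 1..n. a ((?v J)(2 := \<pi> 1 I)))
    - (\<Sum>I = 1..n. \<Sum>J = 1..n. a (?v I)) - (\<Sum>I = 1..n. \<Sum>J = 1..n. a (?v J))"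
    by (simp only: sum.distrib sum_subtractf)
  also have "(\<Sum>I = 1..n. \<Sum>J = 1..n. a ((?v J)(2 := \<pi> 1 I))) = (\<Sum>J = 1..n. \<Sum>I = 1..n. a ((?v J)(2 := \<pi> 1 I)))"
    by (rule sum.swap)
  finally show ?thesis
    unfolding zz by (simp add: perm_sum_def sum_distrib_left[symmetric])
qed

text \<open>
  \<open>swap 1 I J \<pi>\<close> with uniform \<open>I, J\<close> forms an exchangeable pair with \<open>\<pi>\<close>, and by \<open>sum_D\<close> the
  regression of the increment on \<open>\<pi>\<close> is exactly linear in \<open>C \<pi>\<close>; this is Stein's identity for it.
\<close>
lemma stein_identity:
  fixes f :: "real \<Rightarrow> 'b::real_vector"
  shows "avg \<Omega> (\<lambda>\<pi>. C \<pi> *\<^sub>R f (C \<pi>)) = (1 / (4 * real n)) *\<^sub>R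
    avg \<Omega> (\<lambda>\<pi>. \<Sum>I = 1..n. \<Sum>J = 1..n. D \<pi> I J *\<^sub>R (f (C \<pi> + D \<pi> I J) - f (C \<pi>)))"
proof -
  \<comment> \<open>Under the swap, \<open>C\<close> becomes \<open>C + D\<close> and
    \<open>D\<close> becomes \<open>- D\<close>. The factor -2 obtained here and the factor -2n of
    \<open>sum_D\<close> make up the 4n.\<close>
  have *: "avg \<Omega> (\<lambda>\<pi>. D \<pi> I J *\<^sub>R (f (C \<pi> + D \<pi> I J) - f (C \<pi>))) = (-2) *\<^sub>R avg \<Omega> (\<lambda>\<pi>. D \<pi> I J *\<^sub>R f (C \<pi>))"
    if "I \<in> {1..n}" "J \<in> {1..n}" for I J
  proof -
    have "avg \<Omega> (\<lambda>\<pi>. D \<pi> I J *\<^sub>R f (C \<pi>)) = avg \<Omega> (\<lambda>\<pi>. D (swap 1 I J \<pi>) I J *\<^sub>R f (C (swap 1 I J \<pi>)))"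
      using that r2 by (intro avg_perms_swap[symmetric]) auto
    also have "\<dots> = avg \<Omega> (\<lambda>\<pi>. - (D \<pi> I J *\<^sub>R f (C \<pi> + D \<pi> I J)))"
      by (intro avg_cong) (simp add: D_def scaleR_left_diff_distrib)
    finally have "avg \<Omega> (\<lambda>\<pi>. D \<pi> I J *\<^sub>R f (C \<pi> + D \<pi> I J)) = - avg \<Omega> (\<lambda>\<pi>. D \<pi> I J *\<^sub>R f (C \<pi>))"
      by (simp add: avg_minus)
    then show ?thesis by (simp add: scaleR_right_diff_distrib avg_diff scaleR_2)
  qed
  have "avg \<Omega> (\<lambda>\<pi>. \<Sum>I = 1..n. \<Sum>J = 1..n. D \<pi> I J *\<^sub>R (f (C \<pi> + D \<pi> I J) - f (C \<pi>)))
      = (-2) *\<^sub>R avg \<Omega> (\<lambda>\<pi>. \<Sum>I = 1..n. \<Sum>J = 1..n. D \<pi> I J *\<^sub>R f (C \<pi>))"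
    by (simp only: avg_sum * scaleR_sum_right cong: sum.cong)
  also have "\<dots> = (-2) *\<^sub>R avg \<Omega> (\<lambda>\<pi>. (- 2 * real n) *\<^sub>R (C \<pi> *\<^sub>R f (C \<pi>)))"
    by (intro arg_cong[of _ _ "scaleR (-2)"] avg_cong)
      (simp only: scaleR_sum_left[symmetric] sum_D scaleR_scaleR)
  also have "\<dots> = (4 * real n) *\<^sub>R avg \<Omega> (\<lambda>\<pi>. C \<pi> *\<^sub>R f (C \<pi>))"
    unfolding avg_scaleR by simp
  finally show ?thesis using n3 by simp
qed

text \<open>For uniform \<open>I\<close>, \<open>J\<close> the conditional mean of the increment is
  -(2/n) \<open>C\<close>; \<open>T\<close> is its conditional second moment divided by 4/n, twice
  the regression rate.\<close>

definition T :: "(nat \<Rightarrow> nat \<Rightarrow> nat) \<Rightarrow> real" where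
  "T \<pi> = (\<Sum>I = 1..n. \<Sum>J = 1..n. (D \<pi> I J)\<^sup>2) / (4 * real n)"

text \<open>Stein's identity for a constant test function.\<close>

lemma avg_C: "avg \<Omega> C = 0"
  using stein_identity[of "\<lambda>_. 1::real"] by (simp add: avg_def)

text \<open>Stein's identity for the identity function, where each term on the right becomes the
  square of \<open>D\<close>.\<close>

lemma avg_C_sq: "avg \<Omega> (\<lambda>\<pi>. (C \<pi>)\<^sup>2) = avg \<Omega> T"
  using stein_identity[of "\<lambda>x. x"] avg_scaleR[of \<Omega> "1 / (4 * real n)" "\<lambda>\<pi>. \<Sum>I = 1..n. \<Sum>J = 1..n. (D \<pi> I J)\<^sup>2"]
  by (simp add: T_def[abs_def] power2_eq_square)

lemma D_swap_other:
  assumes "I \<in> {1..n}" "J \<in> {1..n}" "{I, J} \<inter> {x, y} = {}"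
  shows "D (swap s x y \<pi>) I J = D \<pi> I J"
  using assms by (simp add: D_eq perm_index_swap_other) (simp add: swap_def)

text \<open>Only pairs \<open>(I, J)\<close> that meet \<open>{x, y}\<close> are affected. Counted
  by \<open>ind I + ind J\<close> they have total weight 4n, which the normalisation of
  \<open>T\<close> cancels.\<close>

lemma T_swap:
  assumes \<pi>: "\<pi> \<in> \<Omega>" and s: "s \<in> {1..r - 1}" and x: "x \<in> {1..n}" and y: "y \<in> {1..n}"
  shows "\<bar>T (swap s x y \<pi>) - T \<pi>\<bar> \<le> 16 * K\<^sup>2"
proof -
  define ind :: "nat \<Rightarrow> real" where "ind = (\<lambda>I. of_bool (I = x) + of_bool (I = y))"
  have d: "\<bar>(D (swap s x y \<pi>) I J)\<^sup>2 - (D \<pi> I J)\<^sup>2\<bar> \<le> 16 * K\<^sup>2 * (ind I + ind J)"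
    if I: "I \<in> {1..n}" and J: "J \<in> {1..n}" for I J
  proof (cases "{I, J} \<inter> {x, y} = {}")
    case True
    then show ?thesis using D_swap_other[OF I J] by (simp add: ind_def)
  next
    case False
    have "(D \<pi>' I J)\<^sup>2 \<le> 16 * K\<^sup>2" if "\<pi>' \<in> \<Omega>" for \<pi>'
      using power_mono[OF D_bound[OF that I J], of 2] by (simp add: power_mult_distrib)
    \<comment> \<open>Both squares lie between 0 and \<open>16 * K\<^sup>2\<close>, so their
      difference does too in absolute value.\<close>
    then have "\<bar>(D (swap s x y \<pi>) I J)\<^sup>2 - (D \<pi> I J)\<^sup>2\<bar> \<le> 16 * K\<^sup>2"
      using \<pi> swap_perms[OF \<pi> s x y] zero_le_power2[of "D \<pi> I J"] zero_le_power2[of "D (swap s x y \<pi>) I J"]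
      by (smt (verit))
    also have "\<dots> \<le> 16 * K\<^sup>2 * (ind I + ind J)"
    proof -
      have "1 \<le> ind I + ind J" using False by (auto simp: ind_def)
      from mult_left_mono[OF this, of "16 * K\<^sup>2"] show ?thesis by simp
    qed
    finally show ?thesis .
  qed
  have sum_ind: "(\<Sum>I = 1..n. ind I) = 2"
    using x y by (simp add: ind_def sum.distrib of_bool_def)
  have "\<bar>T (swap s x y \<pi>) - T \<pi>\<bar> = \<bar>\<Sum>I = 1..n. \<Sum>J = 1..n. (D (swap s x y \<pi>) I J)\<^sup>2 - (D \<pi> I J)\<^sup>2\<bar> / (4 * real n)"
    by (simp add: T_def sum_subtractf diff_divide_distrib[symmetric])
  also have "\<dots> \<le> (\<Sum>I = 1..n. \<Sum>J = 1..n. 16 * K\<^sup>2 * (ind I + ind J)) / (4 * real n)"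
    by (intro divide_right_mono order.trans[OF sum_abs] sum_mono d) auto
  also have "(\<Sum>I = 1..n. \<Sum>J = 1..n. 16 * K\<^sup>2 * (ind I + ind J)) = 16 * K\<^sup>2 * (4 * real n)"
    using sum_ind by (simp add: sum_distrib_left[symmetric] sum.distrib)
  finally show ?thesis using n3 by simp
qed

text \<open>Efron-Stein over the \<open>r - 1\<close> permutations, each coordinate being controlled
  by \<open>var_permutations_le\<close>. For K of order 1 / sqrt n the bound is of order 1 /
  n.\<close>

lemma var_T: "var \<Omega> T \<le> real (r - 1) * (real n * (16 * K\<^sup>2)\<^sup>2)"
proof -
  have "var {p. p permutes {1..n}} (\<lambda>p. T (\<pi>(s := p))) \<le> real (card {1..n}) * (16 * K\<^sup>2)\<^sup>2"
    if s: "s \<in> {1..r - 1}" and \<pi>: "\<pi> \<in> \<Omega>" for s \<pi>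
  proof (rule var_permutations_le)
    fix p x y assume "p permutes {1..n}" "x \<in> {1..n}" "y \<in> {1..n}"
    moreover have "\<pi>(s := p) \<in> \<Omega>"
      using \<pi> s \<open>p permutes {1..n}\<close> by (auto simp: perms_def PiE_iff extensional_def)
    ultimately show "\<bar>T (\<pi>(s := p \<circ> Transposition.transpose x y)) - T (\<pi>(s := p))\<bar> \<le> 16 * K\<^sup>2"
      using T_swap[of "\<pi>(s := p)" s x y] s by (simp add: swap_def)
  qed simp
  then have "var (PiE {1..r - 1} (\<lambda>_. {p. p permutes {1..n}})) T
      \<le> real (card {1..r - 1}) * (real (card {1..n}) * (16 * K\<^sup>2)\<^sup>2)"
    by (intro efron_stein_inequality) (auto simp: finite_permutations perms_def intro: permutes_id)
  then show ?thesis by (simp add: perms_def)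
qed

end

section \<open>The second moment\<close>

lemma card_permutes_fixed:
  assumes "finite S" "a \<in> S" "b \<in> S"
  shows "card {p. p permutes S \<and> p a = b} = fact (card S - 1)"
proof -
  define S' where "S' = S - {a}"
  have S: "S = insert a S'" "a \<notin> S'" "finite S'" using assms by (auto simp: S'_def)
  have eq: "(Transposition.transpose a c \<circ> q) a = c" if "q permutes S'" for q c
    using permutes_not_in[OF that S(2)] by simp
  have "real (card {p. p permutes S \<and> p a = b}) = (\<Sum>p | p permutes S. of_bool (p a = b))"
    using assms(1) by (simp add: finite_permutations Int_def conj_commute)
  also have "\<dots> = (\<Sum>c\<in>S. \<Sum>q | q permutes S'. of_bool (c = b))"
    unfolding S(1) by (subst sum_over_permutations_insert[OF S(3,2)]) (intro sum.cong refl, simp only: eq mem_Collect_eq)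
  also have "\<dots> = fact (card S')"
    using assms(1,3) S(3) by (simp add: card_permutations sum_distrib_left[symmetric] of_bool_def)
  finally have "real (card {p. p permutes S \<and> p a = b}) = real (fact (card S'))" by simp
  then show ?thesis using assms by (simp only: of_nat_eq_iff S'_def card_Diff_singleton)
qed

text \<open>Each multi-index \<open>v\<close> is hit by exactly (n - 1)! ^ (r - 1) pairs of a
  position and a family: the position must be \<open>v 1\<close>, and each permutation has one
  prescribed value.\<close>

lemma sum_avg_perm_index:
  fixes g :: "(nat \<Rightarrow> nat) \<Rightarrow> real"
  assumes r: "1 \<le> r" and n: "1 \<le> n"
  shows "(\<Sum>i = 1..n. avg (perms (r - 1) n) (\<lambda>\<pi>. g (perm_index r \<pi> i)))
    = (\<Sum>v\<in>multi_indices r n. g v) / real n ^ (r - 1)"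
proof -
  let ?P = "perms (r - 1) n" and ?h = "\<lambda>x. perm_index r (snd x) (fst x)"
  have fibre: "card {x \<in> {1..n} \<times> ?P. ?h x = v} = fact (n - 1) ^ (r - 1)"
    if v: "v \<in> multi_indices r n" for v
  proof -
    have v': "v s \<in> {1..n}" if "s \<in> {1..r}" for s
      using v that by (auto simp: multi_indices_def)
    have eq: "perm_index r \<pi> i = v \<longleftrightarrow> i = v 1 \<and> (\<forall>s\<in>{1..r - 1}. \<pi> s i = v (Suc s))" for \<pi> i
    proof
      assume *: "perm_index r \<pi> i = v"
      have "\<pi> s i = v (Suc s)" if "s \<in> {1..r - 1}" for s
        using that unfolding *[symmetric] perm_index_def by auto
      then show "i = v 1 \<and> (\<forall>s\<in>{1..r - 1}. \<pi> s i = v (Suc s))"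
        using r unfolding *[symmetric] perm_index_def by auto
    next
      assume *: "i = v 1 \<and> (\<forall>s\<in>{1..r - 1}. \<pi> s i = v (Suc s))"
      show "perm_index r \<pi> i = v"
      proof
        fix t
        \<comment> \<open>Outside \<open>{1..r}\<close> both functions are \<open>undefined\<close>;
          inside, position 1 is the row index and every other position is shifted by one.\<close>
        consider "t \<notin> {1..r}" | "t = 1" | "t \<in> {1..r}" "t - 1 \<in> {1..r - 1}" "Suc (t - 1) = t" "t \<noteq> 1"
          unfolding atLeastAtMost_iff by arith
        then show "perm_index r \<pi> i t = v t"
        proof cases
          case 1
          then show ?thesis
            using v unfolding perm_index_def multi_indices_def PiE_iff extensional_def
            by (simp only: restrict_def if_False mem_Collect_eq) simp
        next
          case 2
          then show ?thesis using * r by (simp add: perm_index_def)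
        next
          case 3
          then have "perm_index r \<pi> i t = \<pi> (t - 1) i" by (simp add: perm_index_def)
          also have "\<dots> = v (Suc (t - 1))" using * 3(2) by blast
          finally show ?thesis using 3(3) by simp
        qed
      qed
    qed
    have "{x \<in> {1..n} \<times> ?P. ?h x = v}
      = {v 1} \<times> PiE {1..r - 1} (\<lambda>s. {p. p permutes {1..n} \<and> p (v 1) = v (Suc s)})"
      using v'[of 1] r unfolding eq perms_def by (auto simp: PiE_iff)
    moreover have "card {p. p permutes {1..n} \<and> p (v 1) = v (Suc s)} = fact (n - 1)" if "s \<in> {1..r - 1}" for s
      using card_permutes_fixed[of "{1..n}" "v 1" "v (Suc s)"] v'[of 1] v'[of "Suc s"] r that by auto
    ultimately show ?thesis by (simp add: card_PiE card_cartesian_product)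
  qed
  have card: "real (card ?P) = real n ^ (r - 1) * fact (n - 1) ^ (r - 1)"
    using n by (simp add: perms_def card_PiE card_permutations fact_reduce[of n] power_mult_distrib)
  have "(\<Sum>i = 1..n. \<Sum>\<pi>\<in>?P. g (perm_index r \<pi> i)) = (\<Sum>x\<in>{1..n} \<times> ?P. g (?h x))"
    by (simp add: sum.cartesian_product case_prod_unfold)
  also have "\<dots> = (\<Sum>v\<in>multi_indices r n. \<Sum>x\<in>{x \<in> {1..n} \<times> ?P. ?h x = v}. g (?h x))"
  proof (rule sum.group[symmetric])
    show "?h ` ({1..n} \<times> ?P) \<subseteq> multi_indices r n"
      by (rule image_subsetI) (simp add: perm_index_in mem_Times_iff del: atLeastAtMost_iff One_nat_def)
  qed (auto simp: finite_perms multi_indices_def intro!: finite_PiE)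
  also have "\<dots> = (\<Sum>v\<in>multi_indices r n. fact (n - 1) ^ (r - 1) * g v)"
  proof (rule sum.cong[OF refl])
    fix v assume v: "v \<in> multi_indices r n"
    have "(\<Sum>x\<in>{x \<in> {1..n} \<times> ?P. ?h x = v}. g (?h x)) = (\<Sum>x\<in>{x \<in> {1..n} \<times> ?P. ?h x = v}. g v)"
      by (rule sum.cong) auto
    then show "(\<Sum>x\<in>{x \<in> {1..n} \<times> ?P. ?h x = v}. g (?h x)) = fact (n - 1) ^ (r - 1) * g v"
      using fibre[OF v] by simp
  qed
  also have "\<dots> = fact (n - 1) ^ (r - 1) * (\<Sum>v\<in>multi_indices r n. g v)"
    by (simp only: sum_distrib_left)
  finally have "(\<Sum>i = 1..n. avg ?P (\<lambda>\<pi>. g (perm_index r \<pi> i)))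
      = fact (n - 1) ^ (r - 1) * (\<Sum>v\<in>multi_indices r n. g v) / real (card ?P)"
    by (simp add: avg_def divide_inverse sum_distrib_left[symmetric] mult.commute)
  then show ?thesis unfolding card by simp
qed

section \<open>The exact variance of \<open>C\<close>\<close>

context zero_sum_tensor begin

text \<open>
  In the second moment, swap invariance together with the vanishing sums trades one coordinate of
  the second multi-index for the corresponding coordinate of the first one, at the price of a factor
  \<open>- 1 / (n - 1)\<close>; \<open>mix s\<close> is the second multi-index after \<open>s\<close> such trades.
\<close>
definition mix :: "nat \<Rightarrow> (nat \<Rightarrow> nat \<Rightarrow> nat) \<Rightarrow> nat \<Rightarrow> nat \<Rightarrow> nat \<Rightarrow> nat" where
  "mix s \<pi> i i' = (\<lambda>t\<in>{1..r}. if t = 1 then i' else if t \<le> Suc s then \<pi> (t - 1) i else \<pi> (t - 1) i')"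

definition cross :: "nat \<Rightarrow> nat \<Rightarrow> nat \<Rightarrow> real" where
  "cross s i i' = avg \<Omega> (\<lambda>\<pi>. a (perm_index r \<pi> i) * a (mix s \<pi> i i'))"

lemma mix_0: "mix 0 \<pi> i i' = perm_index r \<pi> i'"
  by (auto simp: mix_def perm_index_def fun_eq_iff restrict_def)

text \<open>After all trades the two multi-indices can differ only in coordinate 1, where one more
  vanishing line sum applies.\<close>

lemma mix_last: "mix (r - 1) \<pi> i i' = (perm_index r \<pi> i)(1 := i')"
  using r2 by (auto simp: mix_def perm_index_def fun_eq_iff restrict_def)

lemma mix_Suc: "s < r - 1 \<Longrightarrow> mix (Suc s) \<pi> i i' = (mix s \<pi> i i')(Suc (Suc s) := \<pi> (Suc s) i)"
  by (auto simp: mix_def fun_eq_iff restrict_def le_Suc_eq)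

text \<open>The swapped positions avoid \<open>i\<close>, so the coordinates already traded stay
  put; only the coordinate belonging to permutation \<open>Suc s\<close> changes.\<close>

lemma mix_swap:
  assumes "s < r - 1" "i' \<noteq> i" "k \<noteq> i"
  shows "mix s (swap (Suc s) i' k \<pi>) i i' = (mix s \<pi> i i')(Suc (Suc s) := \<pi> (Suc s) k)"
proof
  fix t
  consider "t = Suc (Suc s)" | "t \<noteq> Suc (Suc s)" "t - 1 = Suc s" "t = 1" | "t - 1 \<noteq> Suc s" by arith
  then show "mix s (swap (Suc s) i' k \<pi>) i i' t = ((mix s \<pi> i i')(Suc (Suc s) := \<pi> (Suc s) k)) t"
    by cases (use assms in \<open>auto simp: mix_def swap_def restrict_def\<close>)
qed

lemma mix_in:
  assumes "\<pi> \<in> \<Omega>" "i \<in> {1..n}" "i' \<in> {1..n}"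
  shows "mix s \<pi> i i' \<in> multi_indices r n"
proof -
  have "mix s \<pi> i i' t \<in> {1..n}" if t: "t \<in> {1..r}" for t
  proof -
    have "perm_index r \<pi> i t \<in> {1..n}" "perm_index r \<pi> i' t \<in> {1..n}"
      using perm_index_in[OF assms(1,2)] perm_index_in[OF assms(1,3)] t
      unfolding multi_indices_def by blast+
    then show ?thesis using t assms(3) by (auto simp: mix_def perm_index_def split: if_splits)
  qed
  then show ?thesis by (auto simp: multi_indices_def mix_def PiE_iff)
qed

text \<open>Swapping \<open>i'\<close> with any \<open>k \<noteq> i\<close> preserves the average
  and the first factor, so \<open>cross s\<close> equals its version with value
  \<open>\<pi> (Suc s) k\<close>. Summed over these n - 1 values, the vanishing line sum leaves
  minus the term \<open>k = i\<close>, which is \<open>mix (Suc s)\<close>.\<close>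

lemma cross_Suc:
  assumes s: "s < r - 1" and i: "i \<in> {1..n}" and i': "i' \<in> {1..n}" and ne: "i' \<noteq> i"
  shows "cross s i i' = - 1 / (real n - 1) * cross (Suc s) i i'"
proof -
  let ?v = "\<lambda>\<pi>. perm_index r \<pi> i" and ?w = "\<lambda>\<pi> k. (mix s \<pi> i i')(Suc (Suc s) := \<pi> (Suc s) k)"
  have "cross s i i' = avg \<Omega> (\<lambda>\<pi>. a (?v \<pi>) * a (?w \<pi> k))" if k: "k \<in> {1..n} - {i}" for k
  proof -
    have "cross s i i' = avg \<Omega> (\<lambda>\<pi>. a (?v (swap (Suc s) i' k \<pi>)) * a (mix s (swap (Suc s) i' k \<pi>) i i'))"
      unfolding cross_def using s i' k by (intro avg_perms_swap[symmetric]) auto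
    also have "\<dots> = avg \<Omega> (\<lambda>\<pi>. a (?v \<pi>) * a (?w \<pi> k))"
      using k ne s by (simp add: perm_index_swap_other mix_swap)
    finally show ?thesis .
  qed
  then have "(\<Sum>k\<in>{1..n} - {i}. cross s i i') = (\<Sum>k\<in>{1..n} - {i}. avg \<Omega> (\<lambda>\<pi>. a (?v \<pi>) * a (?w \<pi> k)))"
    by (rule sum.cong[OF refl])
  also have "\<dots> = avg \<Omega> (\<lambda>\<pi>. a (?v \<pi>) * (\<Sum>k\<in>{1..n} - {i}. a (?w \<pi> k)))"
    by (simp only: avg_sum[symmetric] sum_distrib_left)
  also have "\<dots> = avg \<Omega> (\<lambda>\<pi>. - (a (?v \<pi>) * a (mix (Suc s) \<pi> i i')))"
  proof (rule avg_cong)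
    fix \<pi> assume \<pi>: "\<pi> \<in> \<Omega>"
    have "(\<Sum>k = 1..n. a (?w \<pi> k)) = 0"
      using s by (intro sum_coord_permutes mix_in \<pi> i i' perms_permutes[OF \<pi>]) auto
    then have "(\<Sum>k\<in>{1..n} - {i}. a (?w \<pi> k)) = - a (?w \<pi> i)"
      using i by (simp add: sum_diff1)
    then show "a (?v \<pi>) * (\<Sum>k\<in>{1..n} - {i}. a (?w \<pi> k)) = - (a (?v \<pi>) * a (mix (Suc s) \<pi> i i'))"
      using s by (simp add: mix_Suc)
  qed
  also have "\<dots> = - cross (Suc s) i i'" by (simp add: avg_minus cross_def)
  finally have "(real n - 1) * cross s i i' = - cross (Suc s) i i'"
    using i n3 by (simp add: of_nat_diff)
  then show ?thesis using n3 by (simp add: field_simps)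
qed

lemma cross_0:
  assumes "s \<le> r - 1" "i \<in> {1..n}" "i' \<in> {1..n}" "i' \<noteq> i"
  shows "cross 0 i i' = (- 1 / (real n - 1)) ^ s * cross s i i'"
  using assms(1)
proof (induction s)
  case (Suc s)
  then show ?case using cross_Suc[of s i i'] assms(2-4) by simp
qed simp

text \<open>Off the diagonal, \<open>cross_0\<close> makes all \<open>r - 1\<close> trades; summing
  over \<open>i' \<noteq> i\<close> in coordinate 1 then returns minus the diagonal term, so
  everything is a multiple of the diagonal.\<close>

lemma avg_C_sq_eq:
  "avg \<Omega> (\<lambda>\<pi>. (C \<pi>)\<^sup>2) = (1 - (- 1 / (real n - 1)) ^ (r - 1)) *
    (\<Sum>i = 1..n. avg \<Omega> (\<lambda>\<pi>. (a (perm_index r \<pi> i))\<^sup>2))"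
proof -
  let ?v = "perm_index r" and ?q = "(- 1 / (real n - 1)) ^ (r - 1)"
  have "avg \<Omega> (\<lambda>\<pi>. (C \<pi>)\<^sup>2) = avg \<Omega> (\<lambda>\<pi>. \<Sum>i = 1..n. \<Sum>i' = 1..n. a (?v \<pi> i) * a (?v \<pi> i'))"
    by (simp add: perm_sum_def power2_eq_square sum_product)
  also have "\<dots> = (\<Sum>i = 1..n. \<Sum>i' = 1..n. cross 0 i i')"
    by (simp only: avg_sum cross_def mix_0)
  also have "\<dots> = (\<Sum>i = 1..n. (1 - ?q) * avg \<Omega> (\<lambda>\<pi>. (a (?v \<pi> i))\<^sup>2))"
  proof (rule sum.cong[OF refl])
    fix i assume i: "i \<in> {1..n}"
    have "(\<Sum>i' = 1..n. cross 0 i i') = cross 0 i i + (\<Sum>i'\<in>{1..n} - {i}. cross 0 i i')"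
      using i by (simp add: sum.remove)
    also have "(\<Sum>i'\<in>{1..n} - {i}. cross 0 i i') = (\<Sum>i'\<in>{1..n} - {i}. ?q * cross (r - 1) i i')"
      using i by (intro sum.cong refl cross_0) auto
    also have "\<dots> = ?q * avg \<Omega> (\<lambda>\<pi>. a (?v \<pi> i) * (\<Sum>i'\<in>{1..n} - {i}. a ((?v \<pi> i)(1 := i'))))"
      by (simp only: cross_def mix_last sum_distrib_left[symmetric] avg_sum[symmetric])
    also have "avg \<Omega> (\<lambda>\<pi>. a (?v \<pi> i) * (\<Sum>i'\<in>{1..n} - {i}. a ((?v \<pi> i)(1 := i')))) =
        avg \<Omega> (\<lambda>\<pi>. - (a (?v \<pi> i))\<^sup>2)"
    proof (rule avg_cong)
      fix \<pi> assume \<pi>: "\<pi> \<in> \<Omega>"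
      have "(\<Sum>i' = 1..n. a ((?v \<pi> i)(1 := i'))) = 0"
        using r2 by (intro sum_coord perm_index_in \<pi> i) auto
      moreover have "(?v \<pi> i)(1 := i) = ?v \<pi> i" using r2 by (auto simp: perm_index_def fun_eq_iff)
      ultimately have "(\<Sum>i'\<in>{1..n} - {i}. a ((?v \<pi> i)(1 := i'))) = - a (?v \<pi> i)"
        using i by (simp add: sum_diff1)
      then show "a (?v \<pi> i) * (\<Sum>i'\<in>{1..n} - {i}. a ((?v \<pi> i)(1 := i'))) = - (a (?v \<pi> i))\<^sup>2"
        by (simp add: power2_eq_square)
    qed
    finally show "(\<Sum>i' = 1..n. cross 0 i i') = (1 - ?q) * avg \<Omega> (\<lambda>\<pi>. (a (?v \<pi> i))\<^sup>2)"
      by (simp add: cross_def mix_0 avg_minus power2_eq_square left_diff_distrib)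
  qed
  finally show ?thesis by (simp add: sum_distrib_left)
qed

text \<open>The factor in \<open>avg_C_sq_eq\<close> is at least 1 / 2, and
  \<open>sum_avg_perm_index\<close> turns the diagonal sum into the normalised sum of squared
  entries.\<close>

lemma avg_C_sq_ge: "(\<Sum>v\<in>multi_indices r n. (a v)\<^sup>2) / real n ^ (r - 1) \<le> 2 * avg \<Omega> (\<lambda>\<pi>. (C \<pi>)\<^sup>2)"
proof -
  let ?q = "- 1 / (real n - 1)" and ?S = "(\<Sum>v\<in>multi_indices r n. (a v)\<^sup>2) / real n ^ (r - 1)"
  have q: "\<bar>?q\<bar> \<le> 1 / 2" using n3 by (simp add: field_simps)
  have "\<bar>?q ^ (r - 1)\<bar> \<le> \<bar>?q\<bar> ^ 1"
    unfolding power_abs using q r2 by (intro power_decreasing) auto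
  then have "\<bar>?q ^ (r - 1)\<bar> \<le> 1 / 2" unfolding power_one_right using q by (rule order.trans)
  then have "1 / 2 \<le> 1 - ?q ^ (r - 1)" by linarith
  moreover have "0 \<le> ?S" by (simp add: sum_nonneg)
  ultimately have "1 / 2 * ?S \<le> (1 - ?q ^ (r - 1)) * ?S" by (rule mult_right_mono)
  then show ?thesis
    unfolding avg_C_sq_eq using sum_avg_perm_index[of r n "\<lambda>v. (a v)\<^sup>2"] r2 n3 by simp
qed

section \<open>The characteristic function\<close>

definition \<phi> :: "real \<Rightarrow> complex" where
  "\<phi> u = avg \<Omega> (\<lambda>\<pi>. iexp (u * C \<pi>))"

text \<open>Up to the factor \<i>, the left-hand side of Stein's identity for the exponential;
  \<open>\<phi>_deriv\<close> shows that it is the derivative.\<close>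

definition \<phi>' :: "real \<Rightarrow> complex" where
  "\<phi>' u = \<i> * avg \<Omega> (\<lambda>\<pi>. C \<pi> *\<^sub>R iexp (u * C \<pi>))"

lemma \<phi>_0: "\<phi> 0 = 1"
  by (simp add: \<phi>_def avg_const[OF finite_perms perms_nonempty])

lemma \<phi>_deriv: "(\<phi> has_vector_derivative \<phi>' u) (at u within X)"
proof -
  have "((\<lambda>u. iexp (u * c)) has_vector_derivative \<i> * (c *\<^sub>R iexp (u * c))) (at u within X)" for c :: real
    by (auto intro!: derivative_eq_intros has_vector_derivative_real_field simp: scaleR_conv_of_real)
  then have "((\<lambda>u. \<Sum>\<pi>\<in>\<Omega>. iexp (u * C \<pi>)) has_vector_derivative
      (\<Sum>\<pi>\<in>\<Omega>. \<i> * (C \<pi> *\<^sub>R iexp (u * C \<pi>)))) (at u within X)"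
    by (intro has_vector_derivative_sum) auto
  from bounded_linear.has_vector_derivative[OF bounded_linear_scaleR_right this, of "inverse (real (card \<Omega>))"]
  show ?thesis by (simp add: \<phi>_def[abs_def] \<phi>'_def avg_def sum_distrib_left)
qed

text \<open>Two errors enter: the Taylor remainder of the exponential over a jump \<open>D\<close>,
  and the replacement of \<open>T\<close> by its mean, which costs the mean deviation of
  \<open>T\<close> because the exponential has modulus 1.\<close>

lemma \<phi>_ode:
  "cmod (\<phi>' u + (u * avg \<Omega> T) *\<^sub>R \<phi> u) \<le> \<bar>u\<bar> * sqrt (var \<Omega> T) + 8 * real n * K ^ 3 * u\<^sup>2"
proof -
  define e where "e = (\<lambda>\<pi>. iexp (u * C \<pi>))"
  define R where "R = (\<lambda>x. iexp (u * x) - 1 - \<i> * (u * x))"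
  define E where "E = (\<lambda>\<pi>. (\<Sum>I = 1..n. \<Sum>J = 1..n. D \<pi> I J *\<^sub>R (\<i> * e \<pi> * R (D \<pi> I J))) / (4 * real n))"
  \<comment> \<open>The linear Taylor term carries \<i> twice and so yields minus
    \<open>u * T\<close>; the remainders \<open>R\<close> are collected in \<open>E\<close>.\<close>
  have E: "\<i> * (\<Sum>I = 1..n. \<Sum>J = 1..n. D \<pi> I J *\<^sub>R (iexp (u * (C \<pi> + D \<pi> I J)) - e \<pi>)) / (4 * real n)
      = E \<pi> - (u * T \<pi>) *\<^sub>R e \<pi>" for \<pi>
  proof -
    have "\<i> * (D \<pi> I J *\<^sub>R (iexp (u * (C \<pi> + D \<pi> I J)) - e \<pi>))
      = D \<pi> I J *\<^sub>R (\<i> * e \<pi> * R (D \<pi> I J)) - (u * (D \<pi> I J)\<^sup>2) * e \<pi>" for I J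
      by (simp add: e_def R_def scaleR_conv_of_real algebra_simps exp_add power2_eq_square)
    then have "\<i> * (\<Sum>I = 1..n. \<Sum>J = 1..n. D \<pi> I J *\<^sub>R (iexp (u * (C \<pi> + D \<pi> I J)) - e \<pi>))
      = (\<Sum>I = 1..n. \<Sum>J = 1..n. D \<pi> I J *\<^sub>R (\<i> * e \<pi> * R (D \<pi> I J))) - (\<Sum>I = 1..n. \<Sum>J = 1..n. (u * (D \<pi> I J)\<^sup>2) * e \<pi>)"
      by (simp only: sum_distrib_left sum_subtractf)
    also have "(\<Sum>I = 1..n. \<Sum>J = 1..n. (u * (D \<pi> I J)\<^sup>2) * e \<pi>)
        = of_real (u * (\<Sum>I = 1..n. \<Sum>J = 1..n. (D \<pi> I J)\<^sup>2)) * e \<pi>"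
      by (simp add: sum_distrib_left sum_distrib_right)
    also have "(\<Sum>I = 1..n. \<Sum>J = 1..n. (D \<pi> I J)\<^sup>2) = 4 * real n * T \<pi>"
      using n3 by (simp add: T_def)
    also have "of_real (u * (4 * real n * T \<pi>)) * e \<pi> = (4 * real n) * ((u * T \<pi>) *\<^sub>R e \<pi>)"
      by (simp add: scaleR_conv_of_real)
    finally show ?thesis using n3 by (simp add: E_def diff_divide_distrib scaleR_conv_of_real)
  qed
  have \<phi>_e: "\<phi> u = avg \<Omega> e" by (simp add: \<phi>_def e_def)
  have norm_e: "cmod (e \<pi>) = 1" for \<pi> by (simp add: e_def)
  have norm_R: "cmod (R x) \<le> (u * x)\<^sup>2 / 2" for x
    using iexp_approx1[of "u * x" 1] by (simp add: R_def power2_eq_square diff_diff_eq)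
  have norm_E: "cmod (E \<pi>) \<le> 8 * real n * K ^ 3 * u\<^sup>2" if \<pi>: "\<pi> \<in> \<Omega>" for \<pi>
  proof -
    \<comment> \<open>Half of \<open>(4 * K) ^ 3\<close> is the 32; n * n such pairs divided by 4n
      leave the factor 8n.\<close>
    have "cmod (D \<pi> I J *\<^sub>R (\<i> * e \<pi> * R (D \<pi> I J))) \<le> 32 * K ^ 3 * u\<^sup>2"
      if "I \<in> {1..n}" "J \<in> {1..n}" for I J
    proof -
      have "cmod (D \<pi> I J *\<^sub>R (\<i> * e \<pi> * R (D \<pi> I J))) \<le> \<bar>D \<pi> I J\<bar> * ((u * D \<pi> I J)\<^sup>2 / 2)"
        using mult_left_mono[OF norm_R[of "D \<pi> I J"], of "\<bar>D \<pi> I J\<bar>"] by (simp add: norm_mult norm_e)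
      also have "\<dots> = \<bar>D \<pi> I J\<bar> ^ 3 * u\<^sup>2 / 2"
        by (simp add: power_mult_distrib power3_eq_cube power2_eq_square abs_mult_self_eq)
      also have "\<dots> \<le> (4 * K) ^ 3 * u\<^sup>2 / 2"
        using D_bound[OF \<pi> that] by (intro divide_right_mono mult_right_mono power_mono) auto
      finally show ?thesis by (simp add: power_mult_distrib)
    qed
    then have "cmod (\<Sum>I = 1..n. \<Sum>J = 1..n. D \<pi> I J *\<^sub>R (\<i> * e \<pi> * R (D \<pi> I J))) \<le> (\<Sum>I = 1..n. \<Sum>J = 1..n. 32 * K ^ 3 * u\<^sup>2)"
      by (intro order.trans[OF norm_sum] sum_mono)
    then show ?thesis using n3 by (simp add: E_def norm_divide field_simps)
  qed
  have "\<phi>' u = avg \<Omega> (\<lambda>\<pi>. \<i> * (\<Sum>I = 1..n. \<Sum>J = 1..n. D \<pi> I J *\<^sub>R (iexp (u * (C \<pi> + D \<pi> I J)) - e \<pi>)) / (4 * real n))"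
    using stein_identity[of "\<lambda>x. iexp (u * x)"]
    by (simp add: \<phi>'_def e_def avg_def scaleR_conv_of_real sum_distrib_left sum_divide_distrib field_simps)
  then have "\<phi>' u = avg \<Omega> E - u *\<^sub>R avg \<Omega> (\<lambda>\<pi>. T \<pi> *\<^sub>R e \<pi>)"
    by (simp only: E avg_diff scaleR_scaleR[symmetric] avg_scaleR)
  then have "\<phi>' u + (u * avg \<Omega> T) *\<^sub>R \<phi> u = avg \<Omega> E - u *\<^sub>R avg \<Omega> (\<lambda>\<pi>. (T \<pi> - avg \<Omega> T) *\<^sub>R e \<pi>)"
    by (simp add: \<phi>_e scaleR_left_diff_distrib avg_diff avg_scaleR scaleR_right_diff_distrib)
  then have "cmod (\<phi>' u + (u * avg \<Omega> T) *\<^sub>R \<phi> u)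
      \<le> cmod (avg \<Omega> E) + \<bar>u\<bar> * cmod (avg \<Omega> (\<lambda>\<pi>. (T \<pi> - avg \<Omega> T) *\<^sub>R e \<pi>))"
    using norm_triangle_ineq4[of "avg \<Omega> E" "u *\<^sub>R avg \<Omega> (\<lambda>\<pi>. (T \<pi> - avg \<Omega> T) *\<^sub>R e \<pi>)"]
    by (simp only: norm_scaleR)
  moreover have "cmod (avg \<Omega> E) \<le> 8 * real n * K ^ 3 * u\<^sup>2"
    using norm_avg_le[of \<Omega> E]
      avg_le_const[OF finite_perms perms_nonempty, of "r - 1" n "\<lambda>\<pi>. cmod (E \<pi>)", OF norm_E]
    by linarith
  moreover have "cmod (avg \<Omega> (\<lambda>\<pi>. (T \<pi> - avg \<Omega> T) *\<^sub>R e \<pi>)) \<le> sqrt (var \<Omega> T)"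
    using norm_avg_le[of \<Omega> "\<lambda>\<pi>. (T \<pi> - avg \<Omega> T) *\<^sub>R e \<pi>"]
      avg_abs_dev_le[OF finite_perms perms_nonempty, of "r - 1" n T]
    by (simp add: norm_e)
  then have "\<bar>u\<bar> * cmod (avg \<Omega> (\<lambda>\<pi>. (T \<pi> - avg \<Omega> T) *\<^sub>R e \<pi>)) \<le> \<bar>u\<bar> * sqrt (var \<Omega> T)"
    by (rule mult_left_mono) simp
  ultimately show ?thesis by linarith
qed

text \<open>The integrating factor \<open>exp (v * s\<^sup>2 / 2)\<close> makes the approximate
  differential equation a bound on the derivative of \<open>\<psi>\<close>.\<close>

lemma \<phi>_normal_approx:
  "cmod (\<phi> u - exp (- (avg \<Omega> T * u\<^sup>2 / 2))) \<le> u\<^sup>2 * sqrt (var \<Omega> T) + 8 * real n * K ^ 3 * \<bar>u\<bar> ^ 3"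
proof -
  define v where "v = avg \<Omega> T"
  define B where "B = \<bar>u\<bar> * sqrt (var \<Omega> T) + 8 * real n * K ^ 3 * u\<^sup>2"
  have v: "0 \<le> v"
    unfolding v_def by (intro avg_nonneg) (simp add: T_def sum_nonneg)
  have B: "0 \<le> B"
    using K_nonneg var_nonneg[of \<Omega> T] by (simp add: B_def)
  define \<psi> where "\<psi> = (\<lambda>s. exp (v * s\<^sup>2 / 2) *\<^sub>R \<phi> s)"
  define \<psi>' where "\<psi>' = (\<lambda>s. exp (v * s\<^sup>2 / 2) *\<^sub>R (\<phi>' s + (s * v) *\<^sub>R \<phi> s))"
  have deriv: "(\<psi> has_vector_derivative \<psi>' s) (at s within X)" for s X
  proof -
    have "((\<lambda>s. exp (v * s\<^sup>2 / 2)) has_real_derivative exp (v * s\<^sup>2 / 2) * (s * v)) (at s within X)"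
      by (auto intro!: derivative_eq_intros)
    from has_vector_derivative_scaleR[OF this \<phi>_deriv[of s X]] show ?thesis
      by (simp add: \<psi>_def[abs_def] \<psi>'_def scaleR_right_distrib)
  qed
  have bd: "norm (\<psi>' s) \<le> exp (v * u\<^sup>2 / 2) * B" if s: "s \<in> {- \<bar>u\<bar>..\<bar>u\<bar>}" for s
  proof -
    have su: "\<bar>s\<bar> \<le> \<bar>u\<bar>" using s by auto
    then have su2: "s\<^sup>2 \<le> u\<^sup>2" by (simp add: abs_le_square_iff)
    have "norm (\<phi>' s + (s * v) *\<^sub>R \<phi> s) \<le> \<bar>s\<bar> * sqrt (var \<Omega> T) + 8 * real n * K ^ 3 * s\<^sup>2"
      unfolding v_def by (rule \<phi>_ode)
    also have "\<dots> \<le> B"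
      unfolding B_def using su su2 K_nonneg var_nonneg[of \<Omega> T]
      by (intro add_mono mult_right_mono mult_left_mono) auto
    finally have "norm (\<phi>' s + (s * v) *\<^sub>R \<phi> s) \<le> B" .
    moreover have "exp (v * s\<^sup>2 / 2) \<le> exp (v * u\<^sup>2 / 2)" using v su2 by (simp add: mult_left_mono)
    ultimately show ?thesis unfolding \<psi>'_def by (simp add: mult_mono)
  qed
  \<comment> \<open>Mean value inequality on an interval containing 0 and \<open>u\<close> for
    either sign of \<open>u\<close>. The integrating factor is largest at the endpoints, so it
    cancels afterwards.\<close>
  have "norm (\<psi> u - \<psi> 0) \<le> (exp (v * u\<^sup>2 / 2) * B) * norm (u - 0)"
  proof (rule differentiable_bound[where f' = "\<lambda>s h. h *\<^sub>R \<psi>' s"])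
    show "(\<psi> has_derivative (\<lambda>h. h *\<^sub>R \<psi>' s)) (at s within {- \<bar>u\<bar>..\<bar>u\<bar>})" for s
      using deriv by (simp add: has_vector_derivative_def)
    show "onorm (\<lambda>h. h *\<^sub>R \<psi>' s) \<le> exp (v * u\<^sup>2 / 2) * B" if "s \<in> {- \<bar>u\<bar>..\<bar>u\<bar>}" for s
    proof (rule onorm_bound)
      show "norm (h *\<^sub>R \<psi>' s) \<le> exp (v * u\<^sup>2 / 2) * B * norm h" for h
        using mult_right_mono[OF bd[OF that] norm_ge_zero[of h]] by (simp add: mult.commute)
    qed (use B in simp)
  qed auto
  moreover have "\<psi> u - \<psi> 0 = exp (v * u\<^sup>2 / 2) *\<^sub>R (\<phi> u - exp (- (v * u\<^sup>2 / 2)))"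
    by (simp add: \<psi>_def \<phi>_0 scaleR_right_diff_distrib exp_minus scaleR_conv_of_real[of "exp _" "inverse _"])
  ultimately have "exp (v * u\<^sup>2 / 2) * cmod (\<phi> u - exp (- (v * u\<^sup>2 / 2))) \<le> exp (v * u\<^sup>2 / 2) * (B * \<bar>u\<bar>)"
    by (simp add: mult.assoc)
  then have "cmod (\<phi> u - exp (- (v * u\<^sup>2 / 2))) \<le> B * \<bar>u\<bar>" by simp
  also have "\<dots> = u\<^sup>2 * sqrt (var \<Omega> T) + 8 * real n * K ^ 3 * \<bar>u\<bar> ^ 3"
    by (simp add: B_def algebra_simps power2_eq_square power3_eq_cube)
  finally show ?thesis by (simp add: v_def)
qed

end

section \<open>Transfer to the given probability spaces\<close>

text \<open>Both measures live on a finite discrete space, so it is enough to compare atoms.\<close>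

lemma PiM_uniform_count_measure:
  assumes "finite I" "finite S" "S \<noteq> {}"
  shows "PiM I (\<lambda>_. uniform_count_measure S) = uniform_count_measure (PiE I (\<lambda>_. S))"
proof (rule measure_eqI_countable)
  interpret product_sigma_finite "\<lambda>_. uniform_count_measure S"
  proof
    interpret prob_space "uniform_count_measure S"
      using assms by (intro prob_space_uniform_count_measure)
    show "\<exists>A. countable A \<and> A \<subseteq> sets (uniform_count_measure S) \<and>
        \<Union> A = space (uniform_count_measure S) \<and> (\<forall>a\<in>A. emeasure (uniform_count_measure S) a \<noteq> \<infinity>)"
      by (rule sigma_finite_countable)
  qed
  have "sets (PiM I (\<lambda>_. uniform_count_measure S)) = sets (PiM I (\<lambda>_. count_space S))"
    by (intro sets_PiM_cong refl sets_uniform_count_measure_count_space)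
  also have "\<dots> = Pow (PiE I (\<lambda>_. S))"
    using assms by (subst count_space_PiM_finite) (auto intro: countable_finite)
  finally show "sets (PiM I (\<lambda>_. uniform_count_measure S)) = Pow (PiE I (\<lambda>_. S))" .
  fix f assume f: "f \<in> PiE I (\<lambda>_. S)"
  have "{f} = PiE I (\<lambda>i. {f i})"
    using f by (intro PiE_singleton[symmetric]) (auto simp: PiE_def)
  also have "emeasure (PiM I (\<lambda>_. uniform_count_measure S)) \<dots> = (\<Prod>i\<in>I. emeasure (uniform_count_measure S) {f i})"
    using f assms by (intro emeasure_PiM) (auto simp: sets_uniform_count_measure PiE_iff)
  also have "\<dots> = (\<Prod>i\<in>I. ennreal (1 / card S))"
    using f assms by (intro prod.cong refl) (subst emeasure_uniform_count_measure, auto)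
  also have "\<dots> = emeasure (uniform_count_measure (PiE I (\<lambda>_. S))) {f}"
    using f assms by (subst emeasure_uniform_count_measure)
      (auto simp: card_PiE finite_PiE ennreal_power power_divide)
  finally show "emeasure (PiM I (\<lambda>_. uniform_count_measure S)) {f} = emeasure (uniform_count_measure (PiE I (\<lambda>_. S))) {f}" .
qed (use assms in \<open>auto simp: sets_uniform_count_measure intro!: countable_finite finite_PiE\<close>)

text \<open>Independence makes the joint law the product of the uniform marginals; restricting to
  \<open>{1..m}\<close> makes the family a point of \<open>perms m n\<close>.\<close>

lemma
  assumes X: "indep_uniform_perms M m n X" and m: "1 \<le> m"
  shows measurable_indep_uniform_perms: "(\<lambda>x. \<lambda>s\<in>{1..m}. X s x) \<in> measurable M (count_space (perms m n))"
    and distr_indep_uniform_perms: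
      "distr M (count_space (perms m n)) (\<lambda>x. \<lambda>s\<in>{1..m}. X s x) = uniform_count_measure (perms m n)"
proof -
  let ?S = "{p. p permutes {1..n}}"
  interpret prob_space M using X by (simp add: indep_uniform_perms_def)
  have S: "finite ?S" "?S \<noteq> {}" by (auto simp: finite_permutations intro: permutes_id)
  have indep: "indep_vars (\<lambda>_. count_space ?S) X {1..m}"
    and d: "\<And>s. s \<in> {1..m} \<Longrightarrow> distr M (count_space ?S) (X s) = uniform_count_measure ?S"
    using X by (auto simp: indep_uniform_perms_def)
  have rv: "X s \<in> measurable M (count_space ?S)" if "s \<in> {1..m}" for s
    using indep that by (auto simp: indep_vars_def)
  have P: "PiM {1..m} (\<lambda>_. count_space ?S) = count_space (perms m n)"
    unfolding perms_def using S by (intro count_space_PiM_finite) (auto intro: countable_finite)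
  show "(\<lambda>x. \<lambda>s\<in>{1..m}. X s x) \<in> measurable M (count_space (perms m n))"
    unfolding P[symmetric] using rv by (intro measurable_restrict)
  have "distr M (PiM {1..m} (\<lambda>_. count_space ?S)) (\<lambda>x. \<lambda>s\<in>{1..m}. X s x)
      = PiM {1..m} (\<lambda>s. distr M (count_space ?S) (X s))"
    using indep rv m by (subst indep_vars_iff_distr_eq_PiM'[symmetric]) auto
  also have "\<dots> = PiM {1..m} (\<lambda>_. uniform_count_measure ?S)"
    using d by (intro PiM_cong) auto
  also have "\<dots> = uniform_count_measure (perms m n)"
    unfolding perms_def using S by (intro PiM_uniform_count_measure) auto
  finally show "distr M (count_space (perms m n)) (\<lambda>x. \<lambda>s\<in>{1..m}. X s x) = uniform_count_measure (perms m n)"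
    by (simp only: P)
qed

lemma integral_indep_uniform_perms:
  fixes g :: "_ \<Rightarrow> 'b::{banach, second_countable_topology}"
  assumes X: "indep_uniform_perms M m n X" and m: "1 \<le> m"
  shows "(LINT x|M. g (\<lambda>s\<in>{1..m}. X s x)) = avg (perms m n) g"
proof -
  have "(LINT x|M. g (\<lambda>s\<in>{1..m}. X s x)) =
      integral\<^sup>L (distr M (count_space (perms m n)) (\<lambda>x. \<lambda>s\<in>{1..m}. X s x)) g"
    by (intro integral_distr[symmetric] measurable_indep_uniform_perms[OF X m]) simp
  also have "\<dots> = avg (perms m n) g"
    unfolding distr_indep_uniform_perms[OF X m] uniform_count_measure_def
    using finite_perms[of m n]
    by (simp add: lebesgue_integral_point_measure_finite avg_def scaleR_sum_right divide_inverse)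
  finally show ?thesis .
qed

lemma perm_sum_restrict: "perm_sum r n a (\<lambda>s\<in>{1..r - 1}. \<pi> s) = perm_sum r n a \<pi>"
proof -
  have "perm_index r (\<lambda>s\<in>{1..r - 1}. \<pi> s) i = perm_index r \<pi> i" for i
    by (auto simp: perm_index_def fun_eq_iff restrict_def)
  then show ?thesis by (simp add: perm_sum_def)
qed

section \<open>Passage to the limit in the characteristic functions\<close>

theorem theoremA1:
  fixes r N :: nat
    and a :: "nat \<Rightarrow> (nat \<Rightarrow> nat) \<Rightarrow> real"
    and K1 K2 :: real
    and M :: "nat \<Rightarrow> 'w measure"
    and X :: "nat \<Rightarrow> nat \<Rightarrow> 'w \<Rightarrow> nat \<Rightarrow> nat"
    and C :: "nat \<Rightarrow> 'w \<Rightarrow> real"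
  assumes "r \<ge> 2"
    and "\<And>n s i. n \<ge> N \<Longrightarrow> s \<in> {1..r} \<Longrightarrow> i \<in> multi_indices_omit r n s \<Longrightarrow>
           (\<Sum>j = 1..n. a n (i(s := j))) = 0"
    and "K1 > 0" and "K2 > 0"
    and "\<And>n i. n \<ge> N \<Longrightarrow> i \<in> multi_indices r n \<Longrightarrow> \<bar>a n i\<bar> \<le> K1 / sqrt (real n)"
    and "\<And>n. n \<ge> N \<Longrightarrow> (\<Sum>i\<in>multi_indices r n. (a n i)\<^sup>2) \<ge> K2 * real n ^ (r - 1)"
    and "\<And>n. indep_uniform_perms (M n) (r - 1) n (X n)"
    and "\<And>n \<omega>. C n \<omega> = perm_sum r n (a n) (\<lambda>s. X n s \<omega>)"
  shows "weak_conv_m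
           (\<lambda>n. distr (M n) borel (\<lambda>\<omega>. C n \<omega> / sqrt (prob_space.variance (M n) (C n))))
           std_normal_distribution"
proof (rule levy_continuity)
  let ?m = "r - 1"
  define Y where "Y = (\<lambda>n x. \<lambda>s\<in>{1..?m}. X n s x)"
  define v where "v = (\<lambda>n. prob_space.variance (M n) (C n))"
  have m: "1 \<le> ?m" using assms(1) by simp
  have C: "C n = (\<lambda>x. perm_sum r n (a n) (Y n x))" for n
    by (rule ext) (simp only: assms(8) Y_def perm_sum_restrict)
  have E: "(LINT x|M n. g (Y n x)) = avg (perms ?m n) g" for n and g :: "_ \<Rightarrow> 'b::{banach, second_countable_topology}"
    unfolding Y_def by (rule integral_indep_uniform_perms[OF assms(7) m])
  have meas: "(\<lambda>x. g (Y n x)) \<in> borel_measurable (M n)" for n and g :: "_ \<Rightarrow> real"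
    unfolding Y_def by (rule measurable_compose[OF measurable_indep_uniform_perms[OF assms(7) m]]) simp
  have W_meas: "(\<lambda>x. C n x / sqrt (v n)) \<in> borel_measurable (M n)" for n
    unfolding C by (rule meas)
  show "real_distribution (distr (M n) borel (\<lambda>x. C n x / sqrt (prob_space.variance (M n) (C n))))" for n
  proof -
    interpret prob_space "M n" using assms(7)[of n] by (simp add: indep_uniform_perms_def)
    show ?thesis using W_meas[of n] unfolding v_def by (rule real_distribution_distr)
  qed
  show "real_distribution std_normal_distribution" by (rule real_dist_normal_dist)
  fix t :: real
  \<comment> \<open>Bounds the rescaled argument \<open>t / sqrt (v n)\<close> uniformly in n, since
    the variance is at least \<open>K2 / 2\<close>.\<close>
  define U where "U = sqrt (2 * t\<^sup>2 / K2)"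
  \<comment> \<open>The two error terms of \<open>\<phi>_normal_approx\<close> with
    \<open>K = K1 / sqrt n\<close> and \<open>\<bar>u\<bar> \<le> U\<close>, without their common
    factor 1 / sqrt n.\<close>
  define B where "B = U\<^sup>2 * (16 * K1\<^sup>2 * sqrt (real ?m)) + 8 * K1 ^ 3 * U ^ 3"
  have main: "cmod (char (distr (M n) borel (\<lambda>x. C n x / sqrt (v n))) t - exp (- (t\<^sup>2) / 2)) \<le> B / sqrt (real n)"
    if n: "N \<le> n" "3 \<le> n" for n
  proof -
    define K where "K = K1 / sqrt (real n)"
    interpret zero_sum_tensor r n "a n" K
      using assms(1,2,5) n by unfold_locales (auto simp: K_def)
    interpret M: prob_space "M n" using assms(7)[of n] by (simp add: indep_uniform_perms_def)
    let ?C = "perm_sum r n (a n)"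
    have v_eq: "v n = avg \<Omega> T"
    proof -
      have "M.expectation (C n) = 0" unfolding C E by (rule avg_C)
      then have "v n = M.expectation (\<lambda>x. (?C (Y n x))\<^sup>2)" by (simp add: v_def C)
      then show ?thesis by (simp only: E[of n "\<lambda>y. (?C y)\<^sup>2"] avg_C_sq)
    qed
    have v_ge: "K2 / 2 \<le> v n"
    proof -
      have "K2 \<le> (\<Sum>i\<in>multi_indices r n. (a n i)\<^sup>2) / real n ^ ?m"
        using assms(6)[OF n(1)] n by (simp add: pos_le_divide_eq)
      then show ?thesis using avg_C_sq_ge unfolding v_eq avg_C_sq[symmetric] by linarith
    qed
    then have v_pos: "0 < v n" using assms(4) by simp
    \<comment> \<open>The characteristic function of the standardised sum at \<open>t\<close> is
      \<open>\<phi>\<close> at this \<open>u\<close>, and the Gaussian exponent there becomes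
      \<open>t\<^sup>2 / 2\<close>.\<close>
    define u where "u = t / sqrt (v n)"
    have u: "\<bar>u\<bar> \<le> U"
    proof -
      have "u\<^sup>2 = t\<^sup>2 / v n" using v_pos by (simp add: u_def power_divide)
      also have "\<dots> \<le> t\<^sup>2 / (K2 / 2)" using v_ge assms(4) by (intro divide_left_mono) auto
      finally have "sqrt (u\<^sup>2) \<le> U" unfolding U_def by (intro real_sqrt_le_mono) (simp add: mult.commute)
      then show ?thesis by simp
    qed
    have u2: "u\<^sup>2 \<le> U\<^sup>2" and u3: "\<bar>u\<bar> ^ 3 \<le> U ^ 3"
      using power_mono[OF u, of 2] power_mono[OF u, of 3] by simp_all
    have sn: "0 < sqrt (real n)" using n by simp
    have "sqrt (var \<Omega> T) \<le> sqrt (real ?m * (real n * (16 * K\<^sup>2)\<^sup>2))"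
      by (intro real_sqrt_le_mono var_T)
    also have "real ?m * (real n * (16 * K\<^sup>2)\<^sup>2) = (16 * K1\<^sup>2)\<^sup>2 * real ?m / real n"
      using n by (simp add: K_def power_divide power2_eq_square)
    also have "sqrt \<dots> = 16 * K1\<^sup>2 * sqrt (real ?m) / sqrt (real n)"
      by (simp only: real_sqrt_mult real_sqrt_divide real_sqrt_abs) simp
    finally have sT: "sqrt (var \<Omega> T) \<le> 16 * K1\<^sup>2 * sqrt (real ?m) / sqrt (real n)" .
    have nK: "8 * real n * K ^ 3 = 8 * K1 ^ 3 / sqrt (real n)"
      using n by (simp add: K_def power_divide power3_eq_cube field_simps)
    have "char (distr (M n) borel (\<lambda>x. C n x / sqrt (v n))) t = (CLINT x|M n. iexp (t * (C n x / sqrt (v n))))"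
      unfolding char_def by (rule integral_distr[OF W_meas]) simp
    also have "\<dots> = \<phi> u"
      unfolding C by (subst E[of n "\<lambda>y. iexp (t * (?C y / sqrt (v n)))"]) (simp add: \<phi>_def u_def)
    finally have char: "char (distr (M n) borel (\<lambda>x. C n x / sqrt (v n))) t = \<phi> u" .
    have "v n * u\<^sup>2 / 2 = t\<^sup>2 / 2" using v_pos by (simp add: u_def power_divide)
    then have "cmod (\<phi> u - exp (- (t\<^sup>2) / 2)) \<le> u\<^sup>2 * sqrt (var \<Omega> T) + 8 * real n * K ^ 3 * \<bar>u\<bar> ^ 3"
      using \<phi>_normal_approx[of u] by (simp add: v_eq)
    also have "\<dots> \<le> U\<^sup>2 * (16 * K1\<^sup>2 * sqrt (real ?m) / sqrt (real n)) + 8 * K1 ^ 3 / sqrt (real n) * U ^ 3"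
      unfolding nK using assms(3) sn
      by (intro add_mono mult_mono[OF u2 sT] mult_left_mono[OF u3]) (auto simp: var_nonneg)
    also have "\<dots> = B / sqrt (real n)"
      by (simp add: B_def add_divide_distrib)
    finally show ?thesis by (simp add: char)
  qed
  have "(\<lambda>n. B / sqrt (real n)) \<longlonglongrightarrow> 0"
    by (intro tendsto_divide_0[OF tendsto_const] filterlim_at_top_imp_at_infinity
        filterlim_compose[OF sqrt_at_top filterlim_real_sequentially])
  then have "(\<lambda>n. char (distr (M n) borel (\<lambda>x. C n x / sqrt (v n))) t - exp (- (t\<^sup>2) / 2)) \<longlonglongrightarrow> 0"
  proof (rule Lim_null_comparison[rotated])
    show "\<forall>\<^sub>F n in sequentially.
        cmod (char (distr (M n) borel (\<lambda>x. C n x / sqrt (v n))) t - exp (- (t\<^sup>2) / 2)) \<le> B / sqrt (real n)"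
      using eventually_ge_at_top[of "max N 3"] by eventually_elim (rule main, auto)
  qed
  from LIM_zero_cancel[OF this]
  show "(\<lambda>n. char (distr (M n) borel (\<lambda>x. C n x / sqrt (prob_space.variance (M n) (C n)))) t)
      \<longlonglongrightarrow> char std_normal_distribution t"
    by (simp add: v_def char_std_normal_distribution)
qed

end
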